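(* Let $r(z,\bar z)$ be a real-valued bihomogeneous polynomial of bidegree $(m,m)$ on $\mathbb{C}^n\times\mathbb{C}^n$ with signature pair $(P,N)$ and rank $R$, and let $d$ be a natural number. If $r(z,\bar z)\|z\|^{2d}$ is a squared norm, then $$N\le (P-1)(D_d-1).$$
   Context: For an integer $k\ge 0$, $D_k=\binom{k+n-1}{k}$ is the dimension of the space of homogeneous polynomials of degree $k$ in $z_1,\dots,z_n$ over $\mathbb{C}$. A real-valued bihomogeneous polynomial of bidegree $(m,m)$ is $r(z,\bar z)=\sum_{|\alpha|=|\beta|=m}c_{\alpha\beta}z^\alpha\bar z^\beta$ with $(c_{\alpha\beta})$ a Hermitian matrix. By diagonalizing this matrix one can write $r=\sum_{j=1}^P|f_j(z)|^2-\sum_{k=1}^N|g_k(z)|^2$ with the $f_j,g_k$ holomorphic homogeneous polynomials of degree $m$ that are together linearly independent. The numbers $P$ and $N$ are uniquely determined by $r$ (they are the numbers of positive and negative eigenvalues of $(c_{\alpha\beta})$); $(P,N)$ is the signature pair of $r$, and $R=P+N$ is its rank. A bihomogeneous polynomial is a squared norm if it equals $\|h(z)\|^2=\sum_{k=1}^K|h_k(z)|^2$ for some holomorphic polynomial mapping $h=(h_1,\dots,h_K):\mathbb{C}^n\to\mathbb{C}^K$. Here $\|z\|^2=\sum_{i=1}^n|z_i|^2$.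
   Formalization: The polynomial r is assumed not identically zero; for r = 0 (P = N = 0, trivially a squared norm) the inequality reads 0 ≤ -(D_d - 1), which is false for n ≥ 2, d ≥ 1. *)

theory Defs
  imports "HOL-Analysis.Analysis"
begin

text \<open>
  Polynomials on \<open>\<complex>\<^sup>n\<close> are represented by the functions they induce on \<^typ>\<open>complex ^ 'n\<close>.
  Nothing is lost: over \<open>\<complex>\<close> a polynomial in \<open>z\<close>, and likewise a polynomial in \<open>z\<close> and its
  conjugate, is determined by its values. Multi-indices are functions \<^typ>\<open>'n \<Rightarrow> nat\<close>.
\<close>

definition multi_indices :: "nat \<Rightarrow> ('n::finite \<Rightarrow> nat) set" where
  "multi_indices m = {\<alpha>. (\<Sum>i\<in>UNIV. \<alpha> i) = m}"

definition monomial_fun :: "('n::finite \<Rightarrow> nat) \<Rightarrow> complex ^ 'n \<Rightarrow> complex" where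
  "monomial_fun \<alpha> z = (\<Prod>i\<in>UNIV. (z $ i) ^ \<alpha> i)"

definition holomorphic_polynomial :: "(complex ^ 'n::finite \<Rightarrow> complex) \<Rightarrow> bool" where
  "holomorphic_polynomial f \<longleftrightarrow>
     (\<exists>A a. finite A \<and> (\<forall>z. f z = (\<Sum>\<alpha>\<in>A. a \<alpha> * monomial_fun \<alpha> z)))"

definition homogeneous_polynomial :: "nat \<Rightarrow> (complex ^ 'n::finite \<Rightarrow> complex) \<Rightarrow> bool" where
  "homogeneous_polynomial m f \<longleftrightarrow>
     (\<exists>a. \<forall>z. f z = (\<Sum>\<alpha>\<in>multi_indices m. a \<alpha> * monomial_fun \<alpha> z))"

text \<open>The function \<open>r\<close> below stands for \<open>z \<mapsto> r(z, z\<^sup>*)\<close>, where \<open>z\<^sup>*\<close> is the conjugate of \<open>z\<close>.\<close>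

definition real_bihomogeneous :: "nat \<Rightarrow> (complex ^ 'n::finite \<Rightarrow> real) \<Rightarrow> bool" where
  "real_bihomogeneous m r \<longleftrightarrow>
     (\<exists>c. (\<forall>\<alpha>\<in>multi_indices m. \<forall>\<beta>\<in>multi_indices m. c \<beta> \<alpha> = cnj (c \<alpha> \<beta>)) \<and>
          (\<forall>z. complex_of_real (r z) =
             (\<Sum>\<alpha>\<in>multi_indices m. \<Sum>\<beta>\<in>multi_indices m.
                c \<alpha> \<beta> * monomial_fun \<alpha> z * cnj (monomial_fun \<beta> z))))"

text \<open>
  The third conjunct is linear independence over \<open>\<complex>\<close> of the combined family
  \<open>f\<^sub>0, \<dots>, f\<^sub>P\<^sub>-\<^sub>1, g\<^sub>0, \<dots>, g\<^sub>N\<^sub>-\<^sub>1\<close>.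
\<close>

definition signature_pair ::
  "nat \<Rightarrow> (complex ^ 'n::finite \<Rightarrow> real) \<Rightarrow> nat \<Rightarrow> nat \<Rightarrow> bool" where
  "signature_pair m r P N \<longleftrightarrow>
     (\<exists>f g. (\<forall>j<P. homogeneous_polynomial m (f j)) \<and>
            (\<forall>k<N. homogeneous_polynomial m (g k)) \<and>
            (\<forall>a b. (\<forall>z. (\<Sum>j<P. a j * f j z) + (\<Sum>k<N. b k * g k z) = 0) \<longrightarrow>
                   (\<forall>j<P. a j = 0) \<and> (\<forall>k<N. b k = 0)) \<and>
            (\<forall>z. r z = (\<Sum>j<P. (cmod (f j z))\<^sup>2) - (\<Sum>k<N. (cmod (g k z))\<^sup>2)))"

definition squared_norm :: "(complex ^ 'n::finite \<Rightarrow> real) \<Rightarrow> bool" where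
  "squared_norm s \<longleftrightarrow>
     (\<exists>K h. (\<forall>k<K. holomorphic_polynomial (h k)) \<and>
            (\<forall>z. s z = (\<Sum>k<(K::nat). (cmod (h k z))\<^sup>2)))"

definition hom_dim :: "nat \<Rightarrow> nat \<Rightarrow> nat" where
  "hom_dim n k = (k + n - 1) choose k"

end

theory Submission
  imports Defs "HOL-Computational_Algebra.Polynomial"
begin

text \<open>
  Multiply out \<open>r \<parallel>z\<parallel>\<^sup>2\<^sup>d\<close>: it is a positive combination of the \<open>\<bar>z\<^sup>\<alpha> f\<^sub>j\<bar>\<^sup>2\<close> minus one of the
  \<open>\<bar>z\<^sup>\<alpha> g\<^sub>k\<bar>\<^sup>2\<close>, with \<open>\<alpha>\<close> of degree \<open>d\<close>. If this is a squared norm, polarization shows that a linear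
  functional killing all \<open>z\<^sup>\<alpha> f\<^sub>j\<close> kills all \<open>z\<^sup>\<alpha> g\<^sub>k\<close>. Hence, with \<open>W\<close> the span of the \<open>f\<^sub>j\<close> and
  \<open>g\<^sub>k\<close>, all products of forms of degree \<open>d\<close> with \<open>W\<close> lie in the span of the \<open>P D\<^sub>d\<close> elements
  \<open>z\<^sup>\<alpha> f\<^sub>j\<close>. On the other hand these products span at least \<open>D\<^sub>d + (P + N) - 1\<close> dimensions, and
  comparing the two bounds gives the claim.

  Restricting to a curve \<open>t \<mapsto> (t\<^bsup>w i\<^esup>)\<^sub>i\<close> whose weights separate the monomials involved makes every
  polynomial univariate without losing linear independence. The dimension of a space of univariate
  polynomials is the number of degrees it attains, so the lower bound becomes
  \<open>\<bar>X + Y\<bar> \<ge> \<bar>X\<bar> + \<bar>Y\<bar> - 1\<close> for finite nonempty sets of natural numbers.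
\<close>

section \<open>Dimension of a space of univariate polynomials as the number of attained
  degrees\<close>

interpretation poly_vs: vector_space "smult :: 'a::field \<Rightarrow> 'a poly \<Rightarrow> 'a poly"
  by unfold_locales (simp_all add: smult_add_right smult_add_left)

text \<open>In a nontrivial combination, the member of largest degree with nonzero scalar
  contributes a leading coefficient that nothing else can cancel.\<close>

lemma poly_independent_if_inj_degree:
  fixes S :: "'a::field poly set"
  assumes "inj_on degree S" "0 \<notin> S"
  shows "poly_vs.independent S"
  unfolding poly_vs.independent_explicit_finite_subsets
proof (intro allI impI ballI, rule ccontr)
  fix A u v
  assume A: "A \<subseteq> S" "finite A" and s: "(\<Sum>v\<in>A. smult (u v) v) = 0" and v: "v \<in> A" "u v \<noteq> 0"
  define B where "B = {x\<in>A. u x \<noteq> 0}"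
  have B: "finite B" "B \<noteq> {}" using A v by (auto simp: B_def)
  define n where "n = Max (degree ` B)"
  have "n \<in> degree ` B" unfolding n_def using B by (intro Max_in) auto
  then obtain x where x: "x \<in> B" "degree x = n" by auto
  have z: "u y * coeff y n = 0" if "y \<in> A" "y \<noteq> x" for y
  proof (cases "y \<in> B")
    case True
    then have "degree y \<le> n" using B by (simp add: n_def)
    moreover have "degree y \<noteq> n"
      using assms(1) that x A by (auto simp: inj_on_def B_def)
    ultimately show ?thesis by (simp add: coeff_eq_0)
  next
    case False
    then show ?thesis using that by (simp add: B_def)
  qed
  have "0 = coeff (\<Sum>v\<in>A. smult (u v) v) n" using s by simp
  also have "\<dots> = (\<Sum>v\<in>A. u v * coeff v n)" by (simp add: coeff_sum)
  also have "\<dots> = (\<Sum>v\<in>{x}. u v * coeff v n)"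
    by (rule sum.mono_neutral_right) (use A x z in \<open>auto simp: B_def\<close>)
  finally have "u x * coeff x (degree x) = 0" using x by simp
  then show False using x A assms(2) by (auto simp: B_def)
qed

text \<open>One polynomial chosen for each attained degree gives an independent set inside the span
  of \<open>T\<close>.\<close>

lemma card_degree_span_le:
  fixes T :: "'a::field poly set"
  assumes "finite T"
  shows "finite (degree ` (poly_vs.span T - {0}))"
    and "card (degree ` (poly_vs.span T - {0})) \<le> card T"
proof -
  define U where "U = poly_vs.span T - {0}"
  obtain S where S: "S \<subseteq> U" "inj_on degree S" "degree ` S = degree ` U"
    by (metis subset_image_inj subset_refl)
  have "poly_vs.independent S"
    using S by (intro poly_independent_if_inj_degree) (auto simp: U_def)
  then have *: "finite S \<and> card S \<le> card T"
    using S by (intro poly_vs.independent_span_bound assms) (auto simp: U_def)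
  then show "finite (degree ` (poly_vs.span T - {0}))" using S(3) by (metis U_def finite_imageI)
  show "card (degree ` (poly_vs.span T - {0})) \<le> card T"
    using * S(3) card_image[OF S(2)] by (simp add: U_def)
qed

text \<open>One polynomial chosen for each attained degree spans \<open>U\<close>: subtracting a
  suitable multiple of the representative lowers the degree, and induction does the rest.\<close>

lemma card_independent_le_degree:
  fixes S :: "'a::field poly set"
  assumes "poly_vs.independent S" "poly_vs.subspace U" "S \<subseteq> U" "finite (degree ` (U - {0}))"
  shows "card S \<le> card (degree ` (U - {0}))"
proof -
  obtain B where B: "B \<subseteq> U - {0}" "inj_on degree B" "degree ` B = degree ` (U - {0})"
    by (metis subset_image_inj subset_refl)
  have fB: "finite B" using B assms(4) by (metis finite_imageD)
  have "p \<in> U \<Longrightarrow> p \<in> poly_vs.span B" for p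
  \<comment> \<open>Since \<open>degree 0 = 0\<close>, the measure is shifted by one for nonzero
    \<open>p\<close>, so that cancelling a constant to 0 also decreases it.\<close>
  proof (induction "if p = 0 then 0 else Suc (degree p)" arbitrary: p rule: less_induct)
    case less
    show ?case
    proof (cases "p = 0")
      case True
      then show ?thesis by (simp add: poly_vs.span_zero)
    next
      case False
      then have "degree p \<in> degree ` B" using B less.prems by auto
      then obtain b where b: "b \<in> B" "degree b = degree p" by auto
      then have b': "b \<in> U" "b \<noteq> 0" using B by auto
      define a where "a = lead_coeff p / lead_coeff b"
      define q where "q = p - smult a b"
      have q: "q \<in> U" unfolding q_def
        by (intro poly_vs.subspace_diff poly_vs.subspace_scale assms less.prems b')
      have "coeff b (degree p) = lead_coeff b" by (simp add: b(2))
      then have a: "coeff q (degree p) = 0" using b' by (simp add: q_def a_def)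
      have "degree q \<le> degree p" unfolding q_def
        using b by (intro degree_diff_le) (auto intro: order_trans[OF degree_smult_le])
      with a have "q = 0 \<or> degree q < degree p"
        by (metis leading_coeff_0_iff le_neq_implies_less)
      with False have "(if q = 0 then 0 else Suc (degree q)) < (if p = 0 then 0 else Suc (degree p))"
        by auto
      from less.hyps[OF this q] have "q \<in> poly_vs.span B" .
      then have "q + smult a b \<in> poly_vs.span B"
        by (rule poly_vs.span_add) (intro poly_vs.span_scale poly_vs.span_base b)
      then show ?thesis by (simp add: q_def)
    qed
  qed
  then have "card S \<le> card B"
    using poly_vs.independent_span_bound[OF fB assms(1)] assms(3) by blast
  then show ?thesis using B card_image by metis
qed

section \<open>Sumsets of natural numbers\<close>

text \<open>The translates \<open>X + Min Y\<close> and \<open>Max X + Y\<close> both lie in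
  \<open>Z\<close> and can meet only in \<open>Max X + Min Y\<close>.\<close>

lemma card_sumset_nat_ge:
  fixes X Y Z :: "nat set"
  assumes "finite Z" "X \<noteq> {}" "Y \<noteq> {}" and XY: "\<And>x y. x \<in> X \<Longrightarrow> y \<in> Y \<Longrightarrow> x + y \<in> Z"
    and fin: "finite X" "finite Y"
  shows "card X + card Y \<le> card Z + 1"
proof -
  define A where "A = (\<lambda>x. x + Min Y) ` X"
  define B where "B = (\<lambda>y. Max X + y) ` Y"
  have "A \<union> B \<subseteq> Z" using assms(2,3) fin by (auto simp: A_def B_def intro!: XY Min_in Max_in)
  then have 1: "card (A \<union> B) \<le> card Z" using assms(1) card_mono by blast
  have "A \<inter> B \<subseteq> {Max X + Min Y}"
  proof
    fix n assume "n \<in> A \<inter> B"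
    then obtain x y where "x \<in> X" "y \<in> Y" "n = x + Min Y" "n = Max X + y"
      by (auto simp: A_def B_def)
    moreover have "x \<le> Max X" "Min Y \<le> y" using calculation fin by auto
    ultimately show "n \<in> {Max X + Min Y}" by simp
  qed
  then have 2: "card (A \<inter> B) \<le> 1" using card_mono[of "{Max X + Min Y}"] by fastforce
  have "card A = card X" "card B = card Y"
    by (auto simp: A_def B_def intro!: card_image inj_onI)
  moreover have "card A + card B = card (A \<union> B) + card (A \<inter> B)"
    using fin by (intro card_Un_Int) (auto simp: A_def B_def)
  ultimately show ?thesis using 1 2 by simp
qed

section \<open>Polarization and span membership\<close>

text \<open>
  On the line \<open>s \<mapsto> a + s b\<close> with \<open>a + \<i> b = z\<close> and \<open>a - \<i> b = w\<close>, the Hermitian form is a polynomial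
  in \<open>s\<close> that vanishes on the reals; the claim is its value at \<open>s = \<i>\<close>.
\<close>

lemma hermitian_sum_polarize:
  fixes u :: "'i \<Rightarrow> complex poly" and c :: "'i \<Rightarrow> real"
  assumes "\<And>t. (\<Sum>i\<in>I. c i * (cmod (poly (u i) t))\<^sup>2) = 0"
  shows "(\<Sum>i\<in>I. of_real (c i) * poly (u i) z * cnj (poly (u i) w)) = 0"
proof -
  define a b where "a = (z + w) / 2" and "b = (z - w) / (2 * \<i>)"
  have zw: "a + \<i> * b = z" "a - \<i> * b = w" by (simp_all add: a_def b_def field_simps)
  define q where "q i = pcompose (u i) [:a, b:]" for i
  \<comment> \<open>Conjugating the coefficients keeps \<open>Q\<close> a polynomial in
    \<open>s\<close>: the second factor takes the value of \<open>cnj (q i)\<close> at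
    \<open>cnj s\<close>, which is \<open>s\<close> on the real line and \<open>-\<i>\<close> at
    \<open>s = \<i>\<close>.\<close>
  define Q where "Q = (\<Sum>i\<in>I. smult (of_real (c i)) (q i * map_poly cnj (q i)))"
  have Q: "poly Q s = (\<Sum>i\<in>I. of_real (c i) * poly (u i) (a + s * b) * cnj (poly (u i) (a + cnj s * b)))"
    for s by (simp add: Q_def q_def poly_sum poly_pcompose mult.assoc)
  have "poly Q (of_real s) = 0" for s
  proof -
    have "poly Q (of_real s) = of_real (\<Sum>i\<in>I. c i * (cmod (poly (u i) (a + of_real s * b)))\<^sup>2)"
      unfolding Q by (simp add: complex_norm_square[symmetric] mult.assoc)
    then show ?thesis by (simp add: assms)
  qed
  then have "range of_real \<subseteq> {s. poly Q s = 0}" by auto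
  moreover have "infinite (range (of_real :: real \<Rightarrow> complex))"
    by (simp add: finite_image_iff inj_of_real infinite_UNIV_char_0)
  ultimately have "Q = 0" using poly_roots_finite[of Q] finite_subset by blast
  then have "poly Q \<i> = 0" by simp
  then show ?thesis unfolding Q by (simp add: zw)
qed

text \<open>The polarized identity is linear in the \<open>u i\<close> at \<open>z\<close> and
  conjugate-linear in the \<open>u i\<close> at \<open>w\<close>. Applying \<open>\<phi>\<close> in
  the first slot, conjugating, and applying it in the other slot replaces both evaluations by
  \<open>\<phi>\<close>.\<close>

lemma hermitian_sum_functional:
  fixes u :: "'i \<Rightarrow> complex poly" and c :: "'i \<Rightarrow> real"
  assumes z: "\<And>t. (\<Sum>i\<in>I. c i * (cmod (poly (u i) t))\<^sup>2) = 0"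
    and "Vector_Spaces.linear smult (*) \<phi>"
  shows "(\<Sum>i\<in>I. c i * (cmod (\<phi> (u i)))\<^sup>2) = 0"
proof -
  interpret \<phi>: Vector_Spaces.linear smult "(*)" \<phi> by fact
  have lin: "\<phi> (\<Sum>i\<in>I. smult (k i) (u i)) = (\<Sum>i\<in>I. k i * \<phi> (u i))" for k
    by (simp add: \<phi>.sum \<phi>.scale)
  have 1: "(\<Sum>i\<in>I. of_real (c i) * cnj (poly (u i) w) * \<phi> (u i)) = 0" for w
  proof -
    have "(\<Sum>i\<in>I. smult (of_real (c i) * cnj (poly (u i) w)) (u i)) = 0"
      unfolding poly_all_0_iff_0[symmetric]
      using hermitian_sum_polarize[OF z, where w = w] by (simp add: poly_sum mult_ac)
    from arg_cong[OF this, of \<phi>] show ?thesis by (simp only: lin \<phi>.zero)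
  qed
  have "(\<Sum>i\<in>I. smult (of_real (c i) * cnj (\<phi> (u i))) (u i)) = 0"
    unfolding poly_all_0_iff_0[symmetric]
  proof
    fix w
    from arg_cong[OF 1[of w], of cnj]
    show "poly (\<Sum>i\<in>I. smult (of_real (c i) * cnj (\<phi> (u i))) (u i)) w = 0"
      by (simp add: poly_sum mult_ac)
  qed
  from arg_cong[OF this, of \<phi>]
  have "(\<Sum>i\<in>I. of_real (c i) * cnj (\<phi> (u i)) * \<phi> (u i)) = 0" by (simp only: lin \<phi>.zero)
  also have "(\<Sum>i\<in>I. of_real (c i) * cnj (\<phi> (u i)) * \<phi> (u i))
      = of_real (\<Sum>i\<in>I. c i * (cmod (\<phi> (u i)))\<^sup>2)"
    by (simp add: complex_norm_square[symmetric] mult.assoc mult.commute[of "cnj _"])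
  finally show ?thesis by (simp only: of_real_eq_0_iff)
qed

text \<open>Otherwise some functional kills every \<open>u i\<close> but takes the value 1 at
  \<open>v j\<close>; carried over to it, the identity equates 0 with a positive sum.\<close>

lemma norm_sum_eq_imp_in_span:
  fixes u :: "'i \<Rightarrow> complex poly" and v :: "'j \<Rightarrow> complex poly"
  assumes fin: "finite I" "finite J"
    and eq: "\<And>t. (\<Sum>i\<in>I. c i * (cmod (poly (u i) t))\<^sup>2) = (\<Sum>j\<in>J. b j * (cmod (poly (v j) t))\<^sup>2)"
    and b: "\<And>j. j \<in> J \<Longrightarrow> b j > 0" and j: "j \<in> J"
  shows "v j \<in> poly_vs.span (u ` I)"
proof (rule ccontr)
  assume nin: "v j \<notin> poly_vs.span (u ` I)"
  \<comment> \<open>A functional can be prescribed freely only on an independent set, so the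
    \<open>u i\<close> are first thinned out to a basis of their span.\<close>
  obtain B where B: "B \<subseteq> u ` I" "poly_vs.independent B" "u ` I \<subseteq> poly_vs.span B"
    using poly_vs.maximal_independent_subset by blast
  have vB: "v j \<notin> poly_vs.span B" using nin B(1) poly_vs.span_mono by blast
  interpret vp: vector_space_pair "smult :: complex \<Rightarrow> complex poly \<Rightarrow> complex poly" "(*)"
    by unfold_locales (simp_all add: algebra_simps)
  obtain \<phi> where lin: "Vector_Spaces.linear smult (*) \<phi>"
    and \<phi>: "\<forall>x\<in>insert (v j) B. \<phi> x = (if x = v j then 1 else (0::complex))"
    using vp.linear_independent_extend[OF poly_vs.independent_insertI[OF vB B(2)],
        of "\<lambda>x. if x = v j then 1 else 0"] by auto
  interpret \<phi>: Vector_Spaces.linear smult "(*)" \<phi> by fact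
  have "\<phi> x = 0" if "x \<in> poly_vs.span B" for x
  proof (rule \<phi>.eq_0_on_span[OF _ that])
    show "\<phi> x = 0" if "x \<in> B" for x using that vB \<phi> poly_vs.span_base by auto
  qed
  then have u0: "\<phi> (u i) = 0" if "i \<in> I" for i using B(3) that by blast
  \<comment> \<open>Both sides are merged into one vanishing Hermitian sum over the disjoint union,
    with the signs of the \<open>b j\<close> reversed.\<close>
  have "(\<Sum>i\<in>I <+> J. case_sum c (\<lambda>j. - b j) i * (cmod (\<phi> (case_sum u v i)))\<^sup>2) = 0"
    by (rule hermitian_sum_functional[OF _ lin]) (simp add: sum.Plus fin eq sum_negf)
  then have "(\<Sum>j\<in>J. b j * (cmod (\<phi> (v j)))\<^sup>2) = 0"
    by (simp add: sum.Plus fin u0 sum_negf)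
  moreover have "b j * (cmod (\<phi> (v j)))\<^sup>2 \<le> (\<Sum>j\<in>J. b j * (cmod (\<phi> (v j)))\<^sup>2)"
    using b by (intro member_le_sum fin j) (auto simp: less_imp_le)
  moreover have "\<phi> (v j) = 1" using \<phi> by simp
  ultimately show False using b[OF j] by simp
qed

section \<open>Multi-indices and the expansion of powers of the norm\<close>

lemma multi_indices_le: "\<alpha> \<in> multi_indices d \<Longrightarrow> \<alpha> i \<le> d"
  unfolding multi_indices_def using member_le_sum[of i UNIV \<alpha>] by auto

lemma finite_multi_indices: "finite (multi_indices d :: ('n::finite \<Rightarrow> nat) set)"
proof (rule finite_subset)
  show "multi_indices d \<subseteq> (UNIV \<rightarrow>\<^sub>E {..d} :: ('n \<Rightarrow> nat) set)"
    using multi_indices_le by (auto simp: PiE_def)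
qed (auto intro: finite_PiE)

text \<open>Stars and bars: along an enumeration of the index type, multi-indices become lists of
  fixed length and sum.\<close>

lemma card_multi_indices:
  "card (multi_indices d :: ('n::finite \<Rightarrow> nat) set) = hom_dim CARD('n) d"
proof -
  obtain xs :: "'n list" where xs: "set xs = UNIV" "distinct xs"
    using finite_distinct_list[of "UNIV :: 'n set"] by auto
  then have len: "length xs = CARD('n)" using distinct_card by fastforce
  have "bij_betw (\<lambda>\<alpha>. map \<alpha> xs) (multi_indices d) {l. length l = CARD('n) \<and> sum_list l = d}"
    unfolding bij_betw_def
  proof (intro conjI inj_onI set_eqI iffI)
    fix \<alpha> \<beta> :: "'n \<Rightarrow> nat" assume "map \<alpha> xs = map \<beta> xs"
    then show "\<alpha> = \<beta>" using xs by (auto simp: fun_eq_iff)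
  next
    fix l assume "l \<in> (\<lambda>\<alpha>. map \<alpha> xs) ` multi_indices d"
    then show "l \<in> {l. length l = CARD('n) \<and> sum_list l = d}"
      using xs len by (auto simp: multi_indices_def sum_list_distinct_conv_sum_set)
  next
    fix l assume l: "l \<in> {l. length l = CARD('n) \<and> sum_list l = d}"
    define \<alpha> where "\<alpha> = (\<lambda>i. the (map_of (zip xs l) i))"
    have m: "map \<alpha> xs = l"
      using l len xs by (auto simp: \<alpha>_def intro!: nth_equalityI simp: map_of_zip_nth)
    then have "(\<Sum>i\<in>UNIV. \<alpha> i) = d"
      using l xs by (metis (mono_tags, lifting) mem_Collect_eq sum_list_distinct_conv_sum_set)
    then show "l \<in> (\<lambda>\<alpha>. map \<alpha> xs) ` multi_indices d"
      using m by (auto simp: multi_indices_def)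
  qed
  then show ?thesis
    using bij_betw_same_card card_length_sum_list[of "CARD('n)" d] by (fastforce simp: hom_dim_def)
qed

text \<open>The multinomial theorem with only the positivity of the coefficients recorded, so a
  recursion in \<open>d\<close> replaces the explicit formula.\<close>

lemma sum_power_multi_indices:
  "\<exists>c. (\<forall>\<alpha>\<in>multi_indices d. c \<alpha> > 0) \<and>
     (\<forall>x :: 'n::finite \<Rightarrow> real. (\<Sum>i\<in>UNIV. x i) ^ d
        = (\<Sum>\<alpha>\<in>multi_indices d. c \<alpha> * (\<Prod>i\<in>UNIV. x i ^ \<alpha> i)))"
proof (induction d)
  case 0
  have "multi_indices 0 = {\<lambda>_::'n. 0}" by (auto simp: multi_indices_def)
  then show ?case by (intro exI[of _ "\<lambda>_. 1"]) simp
next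
  case (Suc d)
  then obtain c where c: "\<And>\<alpha>. \<alpha> \<in> multi_indices d \<Longrightarrow> c \<alpha> > 0"
    and e: "\<And>x :: 'n \<Rightarrow> real. (\<Sum>i\<in>UNIV. x i) ^ d
        = (\<Sum>\<alpha>\<in>multi_indices d. c \<alpha> * (\<Prod>i\<in>UNIV. x i ^ \<alpha> i))" by auto
  define dec inc where "dec \<beta> i = \<beta>(i := \<beta> i - 1)" and "inc \<beta> i = \<beta>(i := Suc (\<beta> i))"
    for \<beta> :: "'n \<Rightarrow> nat" and i
  have sum_upd: "(\<Sum>j\<in>UNIV. \<beta> j) = \<beta> i + (\<Sum>j\<in>UNIV-{i}. \<beta> j)" for \<beta> :: "'n \<Rightarrow> nat" and i
    by (simp add: sum.remove)
  have inc: "inc \<alpha> i \<in> multi_indices (Suc d)" if "\<alpha> \<in> multi_indices d" for \<alpha> i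
    using that sum_upd[of \<alpha> i] sum_upd[of "inc \<alpha> i" i] by (simp add: multi_indices_def inc_def)
  have dec: "dec \<beta> i \<in> multi_indices d" if "\<beta> \<in> multi_indices (Suc d)" "\<beta> i > 0" for \<beta> i
    using that sum_upd[of \<beta> i] sum_upd[of "dec \<beta> i" i] by (simp add: multi_indices_def dec_def)
  \<comment> \<open>Pascal's rule: \<open>\<beta>\<close> arises by raising one entry of some
    \<open>dec \<beta> i\<close> with \<open>\<beta> i > 0\<close>.\<close>
  define c' where "c' \<beta> = (\<Sum>i | \<beta> i > 0. c (dec \<beta> i))" for \<beta>
  show ?case
  proof (intro exI[of _ c'] conjI ballI allI)
    fix \<beta> :: "'n \<Rightarrow> nat" assume \<beta>: "\<beta> \<in> multi_indices (Suc d)"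
    then have "\<exists>i. \<beta> i > 0" by (auto simp: multi_indices_def intro: ccontr)
    then show "c' \<beta> > 0" unfolding c'_def
      using \<beta> dec c by (intro sum_pos) auto
  next
    fix x :: "'n \<Rightarrow> real"
    have mon: "(\<Prod>j\<in>UNIV. x j ^ inc \<alpha> i j) = (\<Prod>j\<in>UNIV. x j ^ \<alpha> j) * x i" for \<alpha> i
      by (simp add: prod.remove[of UNIV i] inc_def)
    have "(\<Sum>i\<in>UNIV. x i) ^ Suc d
        = (\<Sum>\<alpha>\<in>multi_indices d. c \<alpha> * (\<Prod>i\<in>UNIV. x i ^ \<alpha> i)) * (\<Sum>i\<in>UNIV. x i)"
      by (simp add: e)
    also have "\<dots> = (\<Sum>(\<alpha>, i)\<in>multi_indices d \<times> UNIV. c \<alpha> * (\<Prod>j\<in>UNIV. x j ^ inc \<alpha> i j))"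
      by (simp add: sum_product sum.cartesian_product mon mult.assoc)
    also have "\<dots> = (\<Sum>(\<beta>, i)\<in>Sigma (multi_indices (Suc d)) (\<lambda>\<beta>. {i. \<beta> i > 0}).
        c (dec \<beta> i) * (\<Prod>j\<in>UNIV. x j ^ \<beta> j))"
      by (rule sum.reindex_bij_witness[where i = "\<lambda>(\<beta>, i). (dec \<beta> i, i)" and j = "\<lambda>(\<alpha>, i). (inc \<alpha> i, i)"])
        (use inc dec in \<open>auto simp: inc_def dec_def\<close>)
    also have "\<dots> = (\<Sum>\<beta>\<in>multi_indices (Suc d). c' \<beta> * (\<Prod>j\<in>UNIV. x j ^ \<beta> j))"
      by (simp add: sum.Sigma[symmetric] finite_multi_indices c'_def sum_distrib_right)
    finally show "(\<Sum>i\<in>UNIV. x i) ^ Suc d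
        = (\<Sum>\<beta>\<in>multi_indices (Suc d). c' \<beta> * (\<Prod>j\<in>UNIV. x j ^ \<beta> j))" .
  qed
qed

text \<open>The multinomial expansion evaluated at the squared moduli of the coordinates.\<close>

lemma norm_power_multi_indices:
  "\<exists>c. (\<forall>\<alpha>\<in>multi_indices d. c \<alpha> > 0) \<and>
     (\<forall>z :: complex ^ 'n::finite. norm z ^ (2 * d)
        = (\<Sum>\<alpha>\<in>multi_indices d. c \<alpha> * (cmod (monomial_fun \<alpha> z))\<^sup>2))"
proof -
  obtain c where c: "\<forall>\<alpha>\<in>multi_indices d. c \<alpha> > 0"
    and e: "\<And>x :: 'n \<Rightarrow> real. (\<Sum>i\<in>UNIV. x i) ^ d
        = (\<Sum>\<alpha>\<in>multi_indices d. c \<alpha> * (\<Prod>i\<in>UNIV. x i ^ \<alpha> i))"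
    using sum_power_multi_indices by blast
  have "norm z ^ (2 * d) = (\<Sum>i\<in>UNIV. (cmod (z $ i))\<^sup>2) ^ d" for z :: "complex ^ 'n"
    by (simp add: power_mult norm_vec_def L2_set_def sum_nonneg)
  then show ?thesis
    using c by (intro exI[of _ c])
      (simp add: e monomial_fun_def prod_norm[symmetric] norm_power prod_power_distrib power_mult[symmetric] mult.commute)
qed

section \<open>Restriction to monomial curves\<close>

text \<open>The lowest base-\<open>k\<close> digit is the residue mod \<open>k\<close>; cancelling
  it and dividing by \<open>k\<close> leaves a shorter expansion.\<close>

lemma digits_unique:
  fixes a b :: "nat \<Rightarrow> nat"
  assumes "\<And>j. j < n \<Longrightarrow> a j < k" "\<And>j. j < n \<Longrightarrow> b j < k"
    and "(\<Sum>j<n. a j * k ^ j) = (\<Sum>j<n. b j * k ^ j)" "j < n"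
  shows "a j = b j"
  using assms
proof (induction n arbitrary: a b j)
  case (Suc n)
  have s: "(\<Sum>j<Suc n. a j * k ^ j) = a 0 + k * (\<Sum>j<n. a (Suc j) * k ^ j)" for a
    by (subst sum.lessThan_Suc_shift) (simp add: sum_distrib_left mult_ac)
  have eq: "a 0 + k * (\<Sum>j<n. a (Suc j) * k ^ j) = b 0 + k * (\<Sum>j<n. b (Suc j) * k ^ j)"
    using Suc.prems(3) by (simp only: s)
  have lt: "a 0 < k" "b 0 < k" using Suc.prems(1,2) by auto
  have 0: "a 0 = b 0" using arg_cong[OF eq, of "\<lambda>x. x mod k"] lt by simp
  then have "(\<Sum>j<n. a (Suc j) * k ^ j) = (\<Sum>j<n. b (Suc j) * k ^ j)" using eq lt by simp
  then have "i < n \<Longrightarrow> a (Suc i) = b (Suc i)" for i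
    using Suc.prems(1,2) by (intro Suc.IH[of "\<lambda>j. a (Suc j)" "\<lambda>j. b (Suc j)"]) auto
  then show ?case using 0 Suc.prems(4) by (cases j) auto
qed simp

text \<open>Kronecker substitution: the weights are distinct powers of \<open>k\<close>.\<close>

lemma ex_weight_inj_on:
  "\<exists>w :: 'n::finite \<Rightarrow> nat. inj_on (\<lambda>\<alpha>. \<Sum>i\<in>UNIV. w i * \<alpha> i) {\<alpha>. \<forall>i. \<alpha> i < k}"
proof -
  obtain e where e: "bij_betw e {0..<CARD('n)} (UNIV :: 'n set)"
    using ex_bij_betw_nat_finite[of "UNIV :: 'n set"] by auto
  define e' where "e' = inv_into {0..<CARD('n)} e"
  define w where "w i = k ^ e' i" for i
  have s: "(\<Sum>i\<in>UNIV. w i * \<alpha> i) = (\<Sum>j<CARD('n). \<alpha> (e j) * k ^ j)" for \<alpha>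
    using e by (subst sum.reindex_bij_betw[OF e, symmetric])
      (auto simp: w_def e'_def bij_betw_def atLeast0LessThan mult.commute intro!: sum.cong)
  show ?thesis
  proof (intro exI[of _ w] inj_onI ext)
    fix \<alpha> \<beta> :: "'n \<Rightarrow> nat" and i
    assume "\<alpha> \<in> {\<alpha>. \<forall>i. \<alpha> i < k}" "\<beta> \<in> {\<alpha>. \<forall>i. \<alpha> i < k}"
      and eq: "(\<Sum>i\<in>UNIV. w i * \<alpha> i) = (\<Sum>i\<in>UNIV. w i * \<beta> i)"
    then have "j < CARD('n) \<Longrightarrow> \<alpha> (e j) = \<beta> (e j)" for j
      by (intro digits_unique[OF _ _ eq[unfolded s]]) auto
    moreover obtain j where "j < CARD('n)" "i = e j"
      using e by (metis UNIV_I atLeastLessThan_iff bij_betw_def imageE)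
    ultimately show "\<alpha> i = \<beta> i" by simp
  qed
qed

definition monomial_curve :: "('n::finite \<Rightarrow> nat) \<Rightarrow> complex \<Rightarrow> complex ^ 'n" where
  "monomial_curve w t = (\<chi> i. t ^ w i)"

lemma monomial_fun_monomial_curve:
  "monomial_fun \<alpha> (monomial_curve w t) = poly (monom 1 (\<Sum>i\<in>UNIV. w i * \<alpha> i)) t"
  by (simp add: monomial_fun_def monomial_curve_def poly_monom power_mult[symmetric] power_sum)

lemma homogeneous_imp_holomorphic_polynomial:
  "homogeneous_polynomial m f \<Longrightarrow> holomorphic_polynomial f"
  unfolding homogeneous_polynomial_def holomorphic_polynomial_def
  using finite_multi_indices by blast

lemma holomorphic_polynomial_monomial_curve:
  assumes "holomorphic_polynomial f"
  shows "\<exists>p. \<forall>t. poly p t = f (monomial_curve w t)"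
proof -
  obtain A a where "\<And>z. f z = (\<Sum>\<alpha>\<in>A. a \<alpha> * monomial_fun \<alpha> z)"
    using assms by (auto simp: holomorphic_polynomial_def)
  then show ?thesis
    by (intro exI[of _ "\<Sum>\<alpha>\<in>A. smult (a \<alpha>) (monom 1 (\<Sum>i\<in>UNIV. w i * \<alpha> i))"])
      (simp add: poly_sum monomial_fun_monomial_curve)
qed

text \<open>Distinct monomials restrict to distinct powers of \<open>t\<close>, so each coefficient
  of \<open>f\<close> reappears alone as a coefficient of the univariate restriction.\<close>

lemma homogeneous_polynomial_eq_0_if_monomial_curve:
  assumes "homogeneous_polynomial m f"
    and inj: "inj_on (\<lambda>\<alpha>. \<Sum>i\<in>UNIV. w i * \<alpha> i) (multi_indices m)"
    and z: "\<And>t. f (monomial_curve w t) = 0"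
  shows "f z = 0"
proof -
  obtain a where a: "\<And>z. f z = (\<Sum>\<alpha>\<in>multi_indices m. a \<alpha> * monomial_fun \<alpha> z)"
    using assms(1) by (auto simp: homogeneous_polynomial_def)
  define wt where "wt \<alpha> = (\<Sum>i\<in>UNIV. w i * \<alpha> i)" for \<alpha>
  define p where "p = (\<Sum>\<alpha>\<in>multi_indices m. monom (a \<alpha>) (wt \<alpha>))"
  have "poly p t = f (monomial_curve w t)" for t
    by (simp add: a p_def poly_sum poly_monom monomial_fun_monomial_curve wt_def)
  then have "p = 0" using z poly_all_0_iff_0 by auto
  have "a \<alpha> = 0" if \<alpha>: "\<alpha> \<in> multi_indices m" for \<alpha>
  proof -
    have "0 = coeff p (wt \<alpha>)" using \<open>p = 0\<close> by simp
    also have "\<dots> = (\<Sum>\<beta>\<in>multi_indices m. if \<beta> = \<alpha> then a \<beta> else 0)"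
      unfolding p_def coeff_sum
      using inj \<alpha> by (intro sum.cong) (auto simp: wt_def inj_on_def)
    also have "\<dots> = a \<alpha>" using \<alpha> by (simp add: finite_multi_indices)
    finally show ?thesis by simp
  qed
  then show ?thesis by (simp add: a)
qed

lemma homogeneous_polynomial_lincomb:
  assumes "\<And>i. i \<in> I \<Longrightarrow> homogeneous_polynomial m (f i)"
  shows "homogeneous_polynomial m (\<lambda>z. \<Sum>i\<in>I. k i * f i z)"
proof -
  obtain a where "\<And>i z. i \<in> I \<Longrightarrow> f i z = (\<Sum>\<alpha>\<in>multi_indices m. a i \<alpha> * monomial_fun \<alpha> z)"
    using assms unfolding homogeneous_polynomial_def by metis
  then have "(\<Sum>i\<in>I. k i * f i z) = (\<Sum>\<alpha>\<in>multi_indices m. (\<Sum>i\<in>I. k i * a i \<alpha>) * monomial_fun \<alpha> z)" for z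
    by (simp add: sum_distrib_left sum_distrib_right mult.assoc sum.swap[of _ I])
  then show ?thesis unfolding homogeneous_polynomial_def
    by (intro exI[of _ "\<lambda>\<alpha>. \<Sum>i\<in>I. k i * a i \<alpha>"]) simp
qed

text \<open>Passes from indexed families to sets, where repetitions would be lost; two equal members
  would give a relation with scalars 1 and -1.\<close>

lemma poly_independent_family:
  fixes u :: "'i \<Rightarrow> 'a::field poly"
  assumes fin: "finite I"
    and ind: "\<And>k i. (\<Sum>i\<in>I. smult (k i) (u i)) = 0 \<Longrightarrow> i \<in> I \<Longrightarrow> k i = 0"
  shows "inj_on u I" "poly_vs.independent (u ` I)"
proof -
  show inj: "inj_on u I"
  proof (rule inj_onI, rule ccontr)
    fix i j assume ij: "i \<in> I" "j \<in> I" "u i = u j" "i \<noteq> j"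
    have "(\<Sum>l\<in>I. smult ((if l = i then 1 else 0) - (if l = j then 1 else 0)) (u l))
        = (\<Sum>l\<in>I. (if l = i then u i else 0) - (if l = j then u j else 0))"
      by (rule sum.cong) auto
    also have "\<dots> = 0" using ij fin by (simp add: sum_subtractf)
    finally show False using ind[of "\<lambda>l. (if l = i then 1 else 0) - (if l = j then 1 else 0)" i] ij by simp
  qed
  show "poly_vs.independent (u ` I)"
  proof (rule poly_vs.independent_if_scalars_zero)
    fix k x assume "(\<Sum>x\<in>u ` I. smult (k x) x) = 0" "x \<in> u ` I"
    then show "k x = 0" using ind[of "\<lambda>i. k (u i)"] inj by (auto simp: sum.reindex)
  qed (use fin in simp)
qed

section \<open>The bound on the signature pair\<close>

theorem corollary1:
  fixes r :: "complex ^ 'n::finite \<Rightarrow> real"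
    and m d P N R :: nat
  assumes "real_bihomogeneous m r"
    and "\<exists>z. r z \<noteq> 0"
    and "signature_pair m r P N"
    and "R = P + N"
    and "squared_norm (\<lambda>z. r z * norm z ^ (2 * d))"
  shows "int N \<le> (int P - 1) * (int (hom_dim CARD('n) d) - 1)"
proof -
  obtain f g where f: "\<And>j. j < P \<Longrightarrow> homogeneous_polynomial m (f j)"
    and g: "\<And>k. k < N \<Longrightarrow> homogeneous_polynomial m (g k)"
    and ind: "\<And>a b. (\<forall>z. (\<Sum>j<P. a j * f j z) + (\<Sum>k<N. b k * g k z) = 0) \<Longrightarrow>
                   (\<forall>j<P. a j = 0) \<and> (\<forall>k<N. b k = 0)"
    and r: "\<And>z. r z = (\<Sum>j<P. (cmod (f j z))\<^sup>2) - (\<Sum>k<N. (cmod (g k z))\<^sup>2)"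
    using assms(3) unfolding signature_pair_def by blast
  obtain K h where h: "\<And>k. k < (K::nat) \<Longrightarrow> holomorphic_polynomial (h k)"
    and sq: "\<And>z. r z * norm z ^ (2 * d) = (\<Sum>k<K. (cmod (h k z))\<^sup>2)"
    using assms(5) unfolding squared_norm_def by blast
  define M where "M = (multi_indices d :: ('n \<Rightarrow> nat) set)"
  have finM: "finite M" by (simp add: M_def finite_multi_indices)
  obtain c where c: "\<And>\<alpha>. \<alpha> \<in> M \<Longrightarrow> c \<alpha> > 0"
    and nz: "\<And>z :: complex ^ 'n. norm z ^ (2 * d) = (\<Sum>\<alpha>\<in>M. c \<alpha> * (cmod (monomial_fun \<alpha> z))\<^sup>2)"
    using norm_power_multi_indices[of d] unfolding M_def by blast
  \<comment> \<open>All entries of multi-indices of degree \<open>m\<close> or \<open>d\<close> are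
    at most \<open>m + d\<close>, so one weight separates the monomials of either degree.\<close>
  obtain w :: "'n \<Rightarrow> nat"
    where w: "inj_on (\<lambda>\<alpha>. \<Sum>i\<in>UNIV. w i * \<alpha> i) {\<alpha>. \<forall>i. \<alpha> i < Suc (m + d)}"
    using ex_weight_inj_on by blast
  have wm: "inj_on (\<lambda>\<alpha>. \<Sum>i\<in>UNIV. w i * \<alpha> i) (multi_indices m)"
    by (rule inj_on_subset[OF w]) (auto simp: less_Suc_eq_le intro: trans_le_add1 multi_indices_le)
  have wd: "inj_on (\<lambda>\<alpha>. \<Sum>i\<in>UNIV. w i * \<alpha> i) M" unfolding M_def
    by (rule inj_on_subset[OF w]) (auto simp: less_Suc_eq_le intro: trans_le_add2 multi_indices_le)
  have ex: "\<exists>p. \<forall>t. poly p t = q (monomial_curve w t)" if "holomorphic_polynomial q" for q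
    using holomorphic_polynomial_monomial_curve that .
  obtain F where F: "\<And>j t. j < P \<Longrightarrow> poly (F j) t = f j (monomial_curve w t)"
    using ex[OF homogeneous_imp_holomorphic_polynomial[OF f]] by metis
  obtain G where G: "\<And>k t. k < N \<Longrightarrow> poly (G k) t = g k (monomial_curve w t)"
    using ex[OF homogeneous_imp_holomorphic_polynomial[OF g]] by metis
  obtain H where H: "\<And>k t. k < K \<Longrightarrow> poly (H k) t = h k (monomial_curve w t)"
    using ex[OF h] by metis
  define mon where "mon \<alpha> = (monom 1 (\<Sum>i\<in>UNIV. w i * \<alpha> i) :: complex poly)" for \<alpha>
  define T where "T = (\<lambda>(\<alpha>, j). mon \<alpha> * F j) ` (M \<times> {..<P})"
  \<comment> \<open>The squared-norm hypothesis on the curve, with the negative terms moved to the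
    right so that all coefficients there are positive.\<close>
  have eq: "(\<Sum>(\<alpha>, j)\<in>M \<times> {..<P}. c \<alpha> * (cmod (poly (mon \<alpha> * F j) t))\<^sup>2)
      = (\<Sum>(\<alpha>, k)\<in>M \<times> {..<N}. c \<alpha> * (cmod (poly (mon \<alpha> * G k) t))\<^sup>2)
        + (\<Sum>k<K. (cmod (poly (H k) t))\<^sup>2)" for t
  proof -
    define z where "z = monomial_curve w t"
    have nz': "norm z ^ (2 * d) = (\<Sum>\<alpha>\<in>M. c \<alpha> * (cmod (poly (mon \<alpha>) t))\<^sup>2)"
      by (simp add: nz z_def monomial_fun_monomial_curve mon_def)
    have rz: "r z = (\<Sum>j<P. (cmod (poly (F j) t))\<^sup>2) - (\<Sum>k<N. (cmod (poly (G k) t))\<^sup>2)"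
      by (simp add: r z_def F G)
    have rn: "r z * norm z ^ (2 * d) = (\<Sum>k<K. (cmod (poly (H k) t))\<^sup>2)"
      by (simp add: sq z_def H)
    have prod: "(\<Sum>(\<alpha>, j)\<in>M \<times> {..<n}. c \<alpha> * (cmod (poly (mon \<alpha> * E j) t))\<^sup>2)
        = (\<Sum>j<n. (cmod (poly (E j) t))\<^sup>2) * (\<Sum>\<alpha>\<in>M. c \<alpha> * (cmod (poly (mon \<alpha>) t))\<^sup>2)"
      for n :: nat and E
      by (simp add: sum_product sum.cartesian_product[symmetric] sum.swap[of _ M]
          norm_mult power_mult_distrib mult_ac)
    show ?thesis unfolding prod using rn[unfolded nz' rz] by (simp add: left_diff_distrib)
  qed
  have FT: "mon \<alpha> * F j \<in> poly_vs.span T" if "\<alpha> \<in> M" "j < P" for \<alpha> j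
    using that by (intro poly_vs.span_base) (auto simp: T_def)
  have GT: "mon \<alpha> * G k \<in> poly_vs.span T" if "\<alpha> \<in> M" "k < N" for \<alpha> k
  proof -
    \<comment> \<open>The right-hand family contains the \<open>H k\<close> besides the products
      with \<open>G k\<close>; the former carry coefficient 1.\<close>
    define v where "v = case_sum (\<lambda>(\<alpha>, k). mon \<alpha> * G k) H"
    have "v (Inl (\<alpha>, k)) \<in> poly_vs.span T"
      unfolding T_def
    proof (rule norm_sum_eq_imp_in_span[where v = v])
      show "(\<Sum>i\<in>M \<times> {..<P}. c (fst i) * (cmod (poly (case i of (\<alpha>, j) \<Rightarrow> mon \<alpha> * F j) t))\<^sup>2) =
          (\<Sum>j\<in>(M \<times> {..<N}) <+> {..<K}. case_sum (\<lambda>i. c (fst i)) (\<lambda>_. 1) j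
            * (cmod (poly (v j) t))\<^sup>2)" for t
        using eq[of t] finM by (simp add: v_def sum.Plus case_prod_unfold)
    qed (use finM c that in auto)
    then show ?thesis by (simp add: v_def)
  qed
  define u where "u = case_sum F G"
  define I where "I = {..<P} <+> {..<N}"
  \<comment> \<open>A relation on the curve lifts to one on the whole space because \<open>w\<close>
    separates monomials of degree \<open>m\<close>; there \<open>ind\<close> applies.\<close>
  have ind': "k i = 0" if s: "(\<Sum>i\<in>I. smult (k i) (u i)) = 0" and i: "i \<in> I" for k i
  proof -
    define q where "q = (\<lambda>z. \<Sum>i\<in>I. k i * case_sum f g i z)"
    have q: "q z = (\<Sum>j<P. k (Inl j) * f j z) + (\<Sum>l<N. k (Inr l) * g l z)" for z
      by (simp add: q_def I_def sum.Plus)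
    have hom: "homogeneous_polynomial m q" unfolding q_def
      by (rule homogeneous_polynomial_lincomb) (auto simp: I_def f g)
    have "q (monomial_curve w t) = poly (\<Sum>i\<in>I. smult (k i) (u i)) t" for t
      by (simp add: q poly_sum I_def u_def sum.Plus F G)
    then have "q (monomial_curve w t) = 0" for t by (simp only: s poly_0)
    then have "q z = 0" for z
      by (rule homogeneous_polynomial_eq_0_if_monomial_curve[OF hom wm])
    then have "(\<forall>j<P. k (Inl j) = 0) \<and> (\<forall>l<N. k (Inr l) = 0)"
      by (intro ind) (simp only: q[symmetric] simp_thms)
    then show ?thesis using i by (auto simp: I_def)
  qed
  have finI: "finite I" by (simp add: I_def)
  have indep: "inj_on u I" "poly_vs.independent (u ` I)"
    using poly_independent_family[of I u] finI ind' by blast+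
  have cardu: "card (u ` I) = P + N"
    using card_image[OF indep(1)] by (simp add: I_def card_Plus)
  \<comment> \<open>The degrees of the restricted monomials of degree \<open>d\<close>, of the span
    of the \<open>F j\<close> and \<open>G k\<close>, and of the span of the products. Their sizes
    are exactly \<open>card M\<close>, at least \<open>P + N\<close>, and at most
    \<open>card M * P\<close>.\<close>
  define X where "X = (\<lambda>\<alpha>. \<Sum>i\<in>UNIV. w i * \<alpha> i) ` M"
  define Y where "Y = degree ` (poly_vs.span (u ` I) - {0})"
  define Z where "Z = degree ` (poly_vs.span T - {0})"
  have finT: "finite T" using finM by (simp add: T_def)
  have Z: "finite Z" "card Z \<le> card M * P"
    using card_degree_span_le[OF finT] card_image_le[of "M \<times> {..<P}"] finM
    by (auto simp: Z_def T_def card_cartesian_product intro: order_trans)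
  have Y: "finite Y" using card_degree_span_le(1)[of "u ` I"] finI by (simp add: Y_def)
  have cY: "P + N \<le> card Y"
    using card_independent_le_degree[OF indep(2) poly_vs.subspace_span poly_vs.span_superset] Y
    by (simp add: Y_def cardu)
  \<comment> \<open>A nonzero \<open>r\<close> excludes \<open>P = N = 0\<close>, where the claimed
    bound would fail as soon as \<open>hom_dim\<close> exceeds 1.\<close>
  have "P + N > 0" using assms(2) by (intro neq0_conv[THEN iffD1] notI) (simp add: r)
  then have Y0: "Y \<noteq> {}" using cY by auto
  have X0: "M \<noteq> {}"
  proof -
    obtain i :: 'n where True by simp
    have "(\<lambda>j. if j = i then d else 0) \<in> M" by (simp add: M_def multi_indices_def)
    then show ?thesis by auto
  qed
  have "card X + card Y \<le> card Z + 1"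
  proof (rule card_sumset_nat_ge)
    fix x y assume "x \<in> X" "y \<in> Y"
    then obtain \<alpha> p where \<alpha>: "\<alpha> \<in> M" "x = degree (mon \<alpha>)"
      and p: "p \<in> poly_vs.span (u ` I)" "p \<noteq> 0" "y = degree p"
      by (auto simp: X_def Y_def mon_def degree_monom_eq)
    \<comment> \<open>Multiplication by \<open>mon \<alpha>\<close> is linear, so the generators
      suffice: \<open>FT\<close> and \<open>GT\<close> cover them.\<close>
    have "mon \<alpha> * p \<in> poly_vs.span T"
      using p(1)
    proof (induction rule: poly_vs.span_induct_alt)
      case base
      then show ?case by (simp add: poly_vs.span_zero)
    next
      case (step a x y)
      then have "mon \<alpha> * x \<in> poly_vs.span T"
        using FT GT \<alpha>(1) by (auto simp: u_def I_def)
      then have "smult a (mon \<alpha> * x) + mon \<alpha> * y \<in> poly_vs.span T"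
        using step by (intro poly_vs.span_add poly_vs.span_scale)
      then show ?case by (simp add: algebra_simps)
    qed
    moreover have "mon \<alpha> \<noteq> 0" by (simp add: mon_def monom_eq_0_iff)
    ultimately show "x + y \<in> Z"
      using p \<alpha> by (auto simp: Z_def degree_mult_eq intro!: image_eqI[of _ _ "mon \<alpha> * p"])
  qed (use Z Y Y0 X0 finM in \<open>auto simp: X_def\<close>)
  moreover have "card X = card M" unfolding X_def by (rule card_image[OF wd])
  ultimately have "card M + (P + N) \<le> card M * P + 1" using cY Z by linarith
  \<comment> \<open>Over the integers this rearranges to the factored bound without truncated
    subtraction.\<close>
  then have "int (card M) + (int P + int N) \<le> int (card M) * int P + 1"
    by (metis of_nat_1 of_nat_add of_nat_le_iff of_nat_mult)
  then show ?thesis by (simp add: M_def card_multi_indices algebra_simps)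
qed

end
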